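(* Let $G$ be a finite group and let $H \leq M$ be subgroups of $G$. Suppose that $\langle H, H^g\rangle \cap M = H$ for all $g \in G$. If $H$ is maximal in $M$ and $M$ is maximal in $G$, then $\langle H^G\rangle \cap M = H$.
   Context: For a subgroup $H$ of $G$ and $g\in G$, $H^g = g^{-1}Hg$, and $\langle H^G\rangle$ denotes the normal closure of $H$ in $G$. "Maximal in" means a maximal (proper) subgroup. *)

theory Defs
  imports "HOL-Algebra.Algebra"
begin

definition conjugate :: "('a, 'b) monoid_scheme \<Rightarrow> 'a set \<Rightarrow> 'a \<Rightarrow> 'a set" where
  "conjugate G H g = inv\<^bsub>G\<^esub> g <#\<^bsub>G\<^esub> (H #>\<^bsub>G\<^esub> g)"

definition normal_closure :: "('a, 'b) monoid_scheme \<Rightarrow> 'a set \<Rightarrow> 'a set" where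
  "normal_closure G H = generate G (\<Union>g\<in>carrier G. conjugate G H g)"

text \<open>For subgroups \<open>H\<close> and \<open>M\<close> of \<open>G\<close>, ``\<open>H\<close> is maximal in \<open>M\<close>'' is
  \<open>maximal_subgroup H (G\<lparr>carrier := M\<rparr>)\<close>.\<close>

definition maximal_subgroup :: "'a set \<Rightarrow> ('a, 'b) monoid_scheme \<Rightarrow> bool" where
  "maximal_subgroup M G \<longleftrightarrow>
     subgroup M G \<and> M \<noteq> carrier G \<and>
     (\<forall>K. subgroup K G \<and> M \<subseteq> K \<longrightarrow> K = M \<or> K = carrier G)"

lemma conjugate_eq_image:
  fixes G (structure)
  assumes "group G" "H \<subseteq> carrier G" "g \<in> carrier G"
  shows "conjugate G H g = (\<lambda>h. inv\<^bsub>G\<^esub> g \<otimes>\<^bsub>G\<^esub> h \<otimes>\<^bsub>G\<^esub> g) ` H"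
proof -
  interpret group G by fact
  have "inv g \<otimes> (h \<otimes> g) = inv g \<otimes> h \<otimes> g" if "h \<in> H" for h
    using assms that by (simp add: m_assoc subset_iff)
  then show ?thesis
    by (auto simp: conjugate_def l_coset_def r_coset_def)
qed

text \<open>\<^const>\<open>normal_closure\<close> is the least normal subgroup containing \<open>H\<close>.\<close>

lemma normal_closure_eq_Inter:
  fixes G (structure)
  assumes "group G" "H \<subseteq> carrier G"
  shows "normal_closure G H = \<Inter>{N. N \<lhd> G \<and> H \<subseteq> N}"
proof -
  interpret group G by fact
  let ?C = "\<Union>g\<in>carrier G. conjugate G H g"
  have mem: "x \<in> ?C \<longleftrightarrow> (\<exists>g\<in>carrier G. \<exists>h\<in>H. x = inv g \<otimes> h \<otimes> g)" for x
    using conjugate_eq_image[OF assms] by auto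
  have C: "?C \<subseteq> carrier G"
  proof
    fix x assume "x \<in> ?C"
    then obtain k h where "k \<in> carrier G" "h \<in> H" "x = inv k \<otimes> h \<otimes> k"
      unfolding mem by blast
    then show "x \<in> carrier G" using assms(2) by auto
  qed
  have HC: "H \<subseteq> ?C"
  proof
    fix h assume "h \<in> H"
    then show "h \<in> ?C"
      unfolding mem using assms(2) by (intro bexI[of _ "\<one>"] bexI[of _ h]) auto
  qed
  have "generate G ?C \<lhd> G"
  proof (rule normal_generateI[OF C])
    fix x g assume "x \<in> ?C" and g: "g \<in> carrier G"
    then obtain k h where k: "k \<in> carrier G" and h: "h \<in> H" and x: "x = inv k \<otimes> h \<otimes> k"
      unfolding mem by blast
    have "g \<otimes> x \<otimes> inv g = inv (k \<otimes> inv g) \<otimes> h \<otimes> (k \<otimes> inv g)"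
      using g k h assms(2) by (simp add: x inv_mult_group m_assoc subset_iff)
    then show "g \<otimes> x \<otimes> inv g \<in> ?C"
      unfolding mem using g k h by (intro bexI[of _ "k \<otimes> inv g"] bexI[of _ h]) auto
  qed
  moreover have "generate G ?C \<subseteq> N" if N: "N \<lhd> G" "H \<subseteq> N" for N
  proof (rule generate_subgroup_incl[OF _ normal_imp_subgroup[OF N(1)]])
    show "?C \<subseteq> N"
    proof
      fix x assume "x \<in> ?C"
      then obtain k h where "k \<in> carrier G" "h \<in> H" "x = inv k \<otimes> h \<otimes> k"
        unfolding mem by blast
      then show "x \<in> N" using N normal.inv_op_closed1[OF N(1)] by auto
    qed
  qed
  moreover have "H \<subseteq> generate G ?C"
    using HC by (meson generate.incl subset_iff)
  ultimately show ?thesis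
    unfolding normal_closure_def by (intro equalityI Inter_greatest Inter_lower) auto
qed

end

theory Submission
  imports Defs
begin

text \<open>
  Write \<open>H\<^sup>g\<close> for \<^term>\<open>conjugate G H g\<close>. For \<open>g \<in> M\<close> the hypothesis puts \<open>H\<^sup>g\<close> inside \<open>H\<close>, so \<open>H\<close>
  is normal in \<open>M\<close>, and \<open>M/H\<close> is abelian because \<open>H\<close> is maximal in \<open>M\<close>
  (\<open>comm_group_FactGroup_if_maximal\<close>). It is enough to find some normal subgroup \<open>L\<close> of \<open>G\<close> with
  \<open>L \<inter> M = H\<close>: it contains the normal closure of \<open>H\<close>. What decides how \<open>L\<close> arises is whether
  the intersections \<open>M \<inter> M\<^sup>g\<close> with \<open>g \<notin> M\<close> all lie in \<open>H\<close>.

  Suppose some \<open>d \<in> M \<inter> M\<^sup>g\<close> is not in \<open>H\<close>. As \<open>H\<close> is normal in \<open>M\<close> and \<open>H\<^sup>g\<close> is normal in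
  \<open>M\<^sup>g\<close>, the element \<open>d\<close> normalizes both, hence also the subgroup \<open>K\<close> that they generate. The
  normalizer of \<open>K\<close> then contains \<open>H\<close> and \<open>d\<close>, which generate \<open>M\<close>, and it also contains an element
  outside \<open>M\<close>. By maximality of \<open>M\<close> it is all of \<open>G\<close>, so \<open>L = K\<close> works, since \<open>K \<inter> M = H\<close> is
  the hypothesis.

  Otherwise this is the situation of the Frobenius--Wielandt theorem, which for an abelian quotient
  \<open>M/H\<close> needs no characters: the transfer into \<open>M/H\<close> extends the projection \<open>M \<rightarrow> M/H\<close>
  to a homomorphism on \<open>G\<close> (\<open>hom_extends_if_trivial_on_intersections\<close>), and \<open>L\<close> is its kernel.
\<close>

section \<open>The transfer homomorphism\<close>

text \<open>
  The argument \<open>r\<close> is a choice of a representative in each right coset of \<open>M\<close>. It is kept explicit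
  because the extension theorem below evaluates the transfer for a choice made to measure.
\<close>

definition transfer ::
    "('a, 'b) monoid_scheme \<Rightarrow> 'a set \<Rightarrow> ('c, 'd) monoid_scheme \<Rightarrow> ('a \<Rightarrow> 'c) \<Rightarrow> ('a set \<Rightarrow> 'a) \<Rightarrow> 'a \<Rightarrow> 'c" where
  "transfer G M A \<phi> r g =
     finprod A (\<lambda>C. \<phi> (r C \<otimes>\<^bsub>G\<^esub> g \<otimes>\<^bsub>G\<^esub> inv\<^bsub>G\<^esub> r (C #>\<^bsub>G\<^esub> g))) (rcosets\<^bsub>G\<^esub> M)"

context group
begin

lemma m_inv_cancel:
  assumes "x \<in> carrier G" "y \<in> carrier G"
  shows "x \<otimes> (inv x \<otimes> y) = y" "inv x \<otimes> (x \<otimes> y) = y"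
  using assms by (simp_all flip: m_assoc)

lemma rcoset_translate_closed:
  assumes "subgroup M G" "C \<in> rcosets M" "g \<in> carrier G"
  shows "C #> g \<in> rcosets M"
  using assms unfolding RCOSETS_def by (force simp: coset_mult_assoc subgroup.subset)

lemma rcoset_translate_translate:
  assumes "subgroup M G" "C \<in> rcosets M" "g \<in> carrier G" "h \<in> carrier G"
  shows "C #> g #> h = C #> (g \<otimes> h)"
  using rcosets_subset_PowG[OF assms(1)] assms(2-4) by (intro coset_mult_assoc) auto

lemma bij_betw_rcoset_translate:
  assumes "subgroup M G" "g \<in> carrier G"
  shows "bij_betw (\<lambda>C. C #> g) (rcosets M) (rcosets M)"
proof (rule bij_betw_byWitness[where f' = "\<lambda>C. C #> inv g"])
  have sub: "C \<subseteq> carrier G" if "C \<in> rcosets M" for C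
    using that rcosets_part_G[OF assms(1)] by auto
  show "\<forall>C\<in>rcosets M. C #> g #> inv g = C" "\<forall>C\<in>rcosets M. C #> inv g #> g = C"
    using assms sub by (auto simp: coset_mult_assoc)
qed (use assms rcoset_translate_closed in auto)

text \<open>Both \<open>r C \<otimes> g\<close> and \<open>r (C #> g)\<close> represent the coset \<open>C #> g\<close>.\<close>

lemma transversal_factor_mem:
  assumes M: "subgroup M G" and r: "\<And>C. C \<in> rcosets M \<Longrightarrow> r C \<in> C"
    and C: "C \<in> rcosets M" and g: "g \<in> carrier G"
  shows "r C \<otimes> g \<otimes> inv r (C #> g) \<in> M"
proof -
  interpret M: subgroup M G by fact
  obtain x where x: "x \<in> carrier G" "C = M #> x"
    using C unfolding RCOSETS_def by auto
  have "C #> g = M #> (x \<otimes> g)"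
    using x g by (simp add: coset_mult_assoc M.subset)
  with r[OF C] r[OF rcoset_translate_closed[OF M C g]] x(2)
  obtain a b where a: "a \<in> M" "r C = a \<otimes> x" and b: "b \<in> M" "r (C #> g) = b \<otimes> (x \<otimes> g)"
    by (metis (mono_tags, lifting) UN_E r_coset_def singletonD)
  have c: "a \<in> carrier G" "b \<in> carrier G" using a b by auto
  have "r C \<otimes> g \<otimes> inv r (C #> g) = a \<otimes> (x \<otimes> g) \<otimes> (inv (x \<otimes> g) \<otimes> inv b)"
    using a(2) b(2) c x(1) g by (simp add: m_assoc inv_mult_group)
  also have "\<dots> = a \<otimes> inv b"
    using c x(1) g by (simp add: inv_mult_group m_assoc m_inv_cancel)
  finally show ?thesis using a b by simp
qed

text \<open>
  The factor of \<open>g \<otimes> h\<close> at \<open>C\<close> telescopes into the factor of \<open>g\<close> at \<open>C\<close> and that of \<open>h\<close> at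
  \<open>C #> g\<close>. Since \<open>A\<close> is commutative the two kinds of factors can be collected separately, and
  \<open>C \<mapsto> C #> g\<close> merely permutes the cosets.
\<close>

lemma transfer_hom:
  assumes M: "subgroup M G" and A: "comm_group A"
    and \<phi>: "\<phi> \<in> hom (G\<lparr>carrier := M\<rparr>) A"
    and r: "\<And>C. C \<in> rcosets M \<Longrightarrow> r C \<in> C"
  shows "transfer G M A \<phi> r \<in> hom G A"
proof -
  interpret A: comm_group A by fact
  have \<phi>c: "\<phi> m \<in> carrier A" if "m \<in> M" for m
    using \<phi> that by (auto simp: hom_def)
  have \<phi>m: "\<phi> (m \<otimes> n) = \<phi> m \<otimes>\<^bsub>A\<^esub> \<phi> n" if "m \<in> M" "n \<in> M" for m n
    using \<phi> that by (auto simp: hom_def)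
  let ?f = "\<lambda>g C. r C \<otimes> g \<otimes> inv r (C #> g)"
  have f: "?f g C \<in> M" if "C \<in> rcosets M" "g \<in> carrier G" for g C
    using transversal_factor_mem[OF M r that] .
  have rc: "r C \<in> carrier G" if "C \<in> rcosets M" for C
    using r[OF that] that rcosets_part_G[OF M] by auto
  have fmul: "?f (g \<otimes> h) C = ?f g C \<otimes> ?f h (C #> g)"
    if C: "C \<in> rcosets M" and g: "g \<in> carrier G" and h: "h \<in> carrier G" for g h C
  proof -
    have "r C \<in> carrier G" "r (C #> g) \<in> carrier G" "r (C #> g #> h) \<in> carrier G"
      using rc C g h by (auto intro!: rcoset_translate_closed[OF M])
    then show ?thesis
      using g h rcoset_translate_translate[OF M C g h]
      by (simp add: m_assoc m_inv_cancel)
  qed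
  show ?thesis
  proof (rule homI)
    fix g assume g: "g \<in> carrier G"
    show "transfer G M A \<phi> r g \<in> carrier A"
      unfolding transfer_def using f[OF _ g] \<phi>c by (intro A.finprod_closed) auto
  next
    fix g h assume g: "g \<in> carrier G" and h: "h \<in> carrier G"
    have cl: "(\<lambda>C. \<phi> (?f k C)) \<in> rcosets M \<rightarrow> carrier A" if "k \<in> carrier G" for k
      using f[OF _ that] \<phi>c by auto
    note bij = bij_betw_rcoset_translate[OF M g]
    have "transfer G M A \<phi> r h = finprod A (\<lambda>C. \<phi> (?f h C)) ((\<lambda>C. C #> g) ` (rcosets M))"
      using bij by (simp add: transfer_def bij_betw_def)
    also have "\<dots> = finprod A (\<lambda>C. \<phi> (?f h (C #> g))) (rcosets M)"
      using bij cl[OF h] by (intro A.finprod_reindex) (auto simp: bij_betw_def)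
    finally have h': "transfer G M A \<phi> r h = \<dots>" .
    have "transfer G M A \<phi> r (g \<otimes> h)
        = finprod A (\<lambda>C. \<phi> (?f g C) \<otimes>\<^bsub>A\<^esub> \<phi> (?f h (C #> g))) (rcosets M)"
      unfolding transfer_def
      using f g h \<phi>c \<phi>m fmul rcoset_translate_closed[OF M]
      by (intro A.finprod_cong') auto
    also have "\<dots> = transfer G M A \<phi> r g \<otimes>\<^bsub>A\<^esub> transfer G M A \<phi> r h"
      unfolding h' transfer_def[of G M A \<phi> r g]
      using cl[OF g] f[OF _ h] \<phi>c rcoset_translate_closed[OF M _ g]
      by (intro A.finprod_multf) auto
    finally show "transfer G M A \<phi> r (g \<otimes> h) = transfer G M A \<phi> r g \<otimes>\<^bsub>A\<^esub> transfer G M A \<phi> r h" .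
  qed
qed

section \<open>Extending a homomorphism from a subgroup\<close>

text \<open>
  The transfer of \<open>\<phi>\<close> is the extension, provided that the representatives of all right cosets in one
  double coset \<open>M t M\<close> are taken from the single left coset \<open>t M\<close>. Right multiplication by
  \<open>m \<in> M\<close> preserves the double coset, so the factor of \<open>m\<close> at such a coset has the form
  \<open>t \<otimes> d \<otimes> inv t\<close> with \<open>d \<in> M\<close>; if \<open>t \<notin> M\<close>, then \<open>\<phi>\<close> is trivial on it by assumption. Only the coset
  \<open>M\<close> itself contributes, with a conjugate of \<open>m\<close> in \<open>M\<close>, whose image is \<open>\<phi> m\<close> as \<open>A\<close> is commutative.
\<close>

lemma hom_extends_if_trivial_on_intersections:
  assumes M: "subgroup M G" and fin: "finite (rcosets M)" and A: "comm_group A"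
    and \<phi>: "\<phi> \<in> hom (G\<lparr>carrier := M\<rparr>) A"
    and triv: "\<And>t d. \<lbrakk>t \<in> carrier G; t \<notin> M; d \<in> M; t \<otimes> d \<otimes> inv t \<in> M\<rbrakk>
                 \<Longrightarrow> \<phi> (t \<otimes> d \<otimes> inv t) = \<one>\<^bsub>A\<^esub>"
  shows "\<exists>\<Phi> \<in> hom G A. \<forall>m\<in>M. \<Phi> m = \<phi> m"
proof -
  interpret M: subgroup M G by fact
  interpret A: comm_group A by fact
  have \<phi>c: "\<phi> m \<in> carrier A" if "m \<in> M" for m
    using \<phi> that by (auto simp: hom_def)
  have \<phi>m: "\<phi> (m \<otimes> n) = \<phi> m \<otimes>\<^bsub>A\<^esub> \<phi> n" if "m \<in> M" "n \<in> M" for m n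
    using \<phi> that by (auto simp: hom_def)
  \<comment> \<open>\<open>t\<close> picks a representative from a double coset, which appears as \<open>C <#> M\<close> for any right
    coset \<open>C\<close> inside it.\<close>
  define t where "t S = (SOME x. x \<in> S)" for S :: "'a set"
  have t: "t (C <#> M) \<in> C <#> M" if C: "C \<in> rcosets M" for C
  proof -
    obtain x where "x \<in> C" using M.rcosets_non_empty[OF C] by blast
    then have "x \<otimes> \<one> \<in> C <#> M"
      unfolding set_mult_def using M.one_closed by blast
    then show ?thesis unfolding t_def by (rule someI)
  qed
  have "\<exists>y. y \<in> C \<and> (\<exists>s\<in>M. y = t (C <#> M) \<otimes> s)" if "C \<in> rcosets M" for C
  proof -
    from t[OF that] obtain y b where y: "y \<in> C" "b \<in> M" "t (C <#> M) = y \<otimes> b"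
      unfolding set_mult_def by blast
    have "y \<in> carrier G" using y that rcosets_part_G[OF M] by auto
    with y have "y = t (C <#> M) \<otimes> inv b" by (simp add: m_assoc)
    with y show ?thesis by blast
  qed
  \<comment> \<open>Every right coset in a double coset meets every left coset in it, so \<open>r\<close> can follow \<open>t\<close>.\<close>
  then have "\<exists>r. \<forall>C\<in>rcosets M. r C \<in> C \<and> (\<exists>s\<in>M. r C = t (C <#> M) \<otimes> s)"
    by (intro bchoice ballI)
  then obtain r where r: "\<And>C. C \<in> rcosets M \<Longrightarrow> r C \<in> C"
    and rt: "\<And>C. C \<in> rcosets M \<Longrightarrow> \<exists>s\<in>M. r C = t (C <#> M) \<otimes> s"
    by blast
  let ?f = "\<lambda>g C. r C \<otimes> g \<otimes> inv r (C #> g)"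
  have f: "?f g C \<in> M" if "C \<in> rcosets M" "g \<in> carrier G" for g C
    using transversal_factor_mem[OF M r that] .
  have Mcos: "M \<in> rcosets M" using M.subgroup_in_rcosets[OF is_group] .
  have other: "\<phi> (?f m C) = \<one>\<^bsub>A\<^esub>" if m: "m \<in> M" and C: "C \<in> rcosets M" "C \<noteq> M" for m C
  proof -
    have mG: "m \<in> carrier G" using m by auto
    have Cs: "C \<subseteq> carrier G" using C rcosets_part_G[OF M] by auto
    have "(C #> m) <#> M = C <#> M"
    proof -
      have "(C #> m) <#> M = C <#> (m <# M)"
        using rcos_assoc_lcos[of C M m] Cs mG M.subset by simp
      also have "m <# M = M" using m M by (simp add: coset_join3)
      finally show ?thesis .
    qed
    with rt[OF C(1)] rt[OF rcoset_translate_closed[OF M C(1) mG]]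
    obtain s s' where s: "s \<in> M" "r C = t (C <#> M) \<otimes> s"
      and s': "s' \<in> M" "r (C #> m) = t (C <#> M) \<otimes> s'"
      by auto
    let ?t = "t (C <#> M)"
    have tG: "?t \<in> carrier G"
      using t[OF C(1)] Cs M.subset set_mult_closed by blast
    have tM: "?t \<notin> M"
    proof
      assume "?t \<in> M"
      then have "r C \<in> M" using s by simp
      with r[OF C(1)] C Mcos show False
        using rcos_disjoint[OF M] unfolding pairwise_def disjnt_def by blast
    qed
    have "?f m C = ?t \<otimes> (s \<otimes> m \<otimes> inv s') \<otimes> inv ?t"
      using s s' tG m by (simp add: m_assoc inv_mult_group)
    then show ?thesis
      using triv[OF tG tM, of "s \<otimes> m \<otimes> inv s'"] f[OF C(1) mG] s s' m by simp
  qed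
  have base: "\<phi> (?f m M) = \<phi> m" if m: "m \<in> M" for m
  proof -
    have y: "r M \<in> M" using r[OF Mcos] .
    have "M #> m = M" using m M by (simp add: coset_join2)
    then have "?f m M \<otimes> r M = r M \<otimes> m" using y m by (simp add: m_assoc)
    \<comment> \<open>The factor at \<open>M\<close> is the conjugate of \<open>m\<close> by \<open>r M\<close>, and \<open>A\<close> cannot see the conjugation.\<close>
    then have "\<phi> (?f m M) \<otimes>\<^bsub>A\<^esub> \<phi> (r M) = \<phi> (r M) \<otimes>\<^bsub>A\<^esub> \<phi> m"
      using \<phi>m y m f[OF Mcos, of m] by (metis M.mem_carrier)
    then have "\<phi> (?f m M) \<otimes>\<^bsub>A\<^esub> \<phi> (r M) = \<phi> m \<otimes>\<^bsub>A\<^esub> \<phi> (r M)"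
      using \<phi>c y m by (simp add: A.m_comm)
    then show ?thesis using \<phi>c y m f[OF Mcos, of m] by (simp add: M.mem_carrier)
  qed
  have "transfer G M A \<phi> r m = \<phi> m" if m: "m \<in> M" for m
  proof -
    have "transfer G M A \<phi> r m = finprod A (\<lambda>C. if M = C then \<phi> m else \<one>\<^bsub>A\<^esub>) (rcosets M)"
      unfolding transfer_def
      using other[OF m] base[OF m] \<phi>c[OF m] by (intro A.finprod_cong') auto
    also have "\<dots> = \<phi> m"
      using A.finprod_singleton[OF Mcos fin, of "\<lambda>_. \<phi> m"] \<phi>c[OF m] by simp
    finally show ?thesis .
  qed
  with transfer_hom[OF M A \<phi> r] show ?thesis by blast
qed

section \<open>Normalizers and maximal subgroups\<close>

lemma subset_if_maximal_and_larger:
  assumes M: "subgroup M G" and max: "maximal_subgroup H (G\<lparr>carrier := M\<rparr>)"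
    and K: "subgroup K G" "H \<subseteq> K" and x: "x \<in> K" "x \<in> M" "x \<notin> H"
  shows "M \<subseteq> K"
proof -
  have "subgroup (K \<inter> M) (G\<lparr>carrier := M\<rparr>)"
    using subgroups_Inter_pair[OF K(1) M] M by (intro subgroup_incl) auto
  moreover have "H \<subseteq> M"
    using max subgroup.subset unfolding maximal_subgroup_def by force
  ultimately show ?thesis
    using max K(2) x unfolding maximal_subgroup_def by auto
qed

text \<open>
  The normalizer of a subgroup \<open>K\<close>, described through elements. Asking for both \<open>x\<close> and its inverse
  makes this a subgroup for infinite \<open>K\<close> as well.
\<close>

definition normalizing_elements :: "'a set \<Rightarrow> 'a set" where
  "normalizing_elements K =
     {x \<in> carrier G. \<forall>k\<in>K. x \<otimes> k \<otimes> inv x \<in> K \<and> inv x \<otimes> k \<otimes> x \<in> K}"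

lemma subgroup_normalizing_elements:
  assumes "K \<subseteq> carrier G"
  shows "subgroup (normalizing_elements K) G"
proof (rule subgroupI)
  have "\<one> \<in> normalizing_elements K"
    using assms by (auto simp: normalizing_elements_def)
  then show "normalizing_elements K \<noteq> {}" by auto
next
  fix x y assume x: "x \<in> normalizing_elements K" and y: "y \<in> normalizing_elements K"
  then have c: "x \<in> carrier G" "y \<in> carrier G" by (auto simp: normalizing_elements_def)
  have "x \<otimes> y \<otimes> k \<otimes> inv (x \<otimes> y) \<in> K \<and> inv (x \<otimes> y) \<otimes> k \<otimes> (x \<otimes> y) \<in> K" if k: "k \<in> K" for k
  proof -
    have "k \<in> carrier G" using k assms by auto
    then have "x \<otimes> y \<otimes> k \<otimes> inv (x \<otimes> y) = x \<otimes> (y \<otimes> k \<otimes> inv y) \<otimes> inv x"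
      "inv (x \<otimes> y) \<otimes> k \<otimes> (x \<otimes> y) = inv y \<otimes> (inv x \<otimes> k \<otimes> x) \<otimes> y"
      using c by (simp_all add: m_assoc inv_mult_group)
    then show ?thesis using x y k by (simp add: normalizing_elements_def)
  qed
  with c show "x \<otimes> y \<in> normalizing_elements K" by (simp add: normalizing_elements_def)
qed (auto simp: normalizing_elements_def)

lemma subgroup_subset_normalizing_elements:
  assumes "subgroup K G"
  shows "K \<subseteq> normalizing_elements K"
  using assms by (auto simp: normalizing_elements_def subgroup.mem_carrier
      intro!: subgroup.m_closed subgroup.m_inv_closed)

lemma normal_if_normalizing_elements_eq:
  assumes "subgroup K G" "normalizing_elements K = carrier G"
  shows "K \<lhd> G"
  using assms by (auto simp: normal_inv_iff normalizing_elements_def)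

lemma conj_generate_mem:
  assumes S: "S \<subseteq> carrier G" and x: "x \<in> carrier G"
    and conj: "\<And>s. s \<in> S \<Longrightarrow> x \<otimes> s \<otimes> inv x \<in> generate G S"
    and k: "k \<in> generate G S"
  shows "x \<otimes> k \<otimes> inv x \<in> generate G S"
  using k
proof (induction k rule: generate.induct)
  case one
  then show ?case using x by (simp add: generate.one)
next
  case (incl h)
  then show ?case by (rule conj)
next
  case (inv h)
  then have "x \<otimes> inv h \<otimes> inv x = inv (x \<otimes> h \<otimes> inv x)"
    using S x by (auto simp: inv_mult_group m_assoc)
  then show ?case using generate_m_inv_closed[OF S conj[OF inv]] by simp
next
  case (eng h1 h2)
  then have "h1 \<in> carrier G" "h2 \<in> carrier G" using generate_in_carrier[OF S] by auto
  then have "x \<otimes> (h1 \<otimes> h2) \<otimes> inv x = (x \<otimes> h1 \<otimes> inv x) \<otimes> (x \<otimes> h2 \<otimes> inv x)"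
    using x by (simp add: m_assoc m_inv_cancel)
  then show ?case using generate.eng[OF eng.IH] by simp
qed

end

text \<open>
  An element \<open>a \<notin> H\<close> commutes modulo \<open>H\<close> with itself and with all of \<open>H\<close>. The elements that commute
  with \<open>a\<close> modulo \<open>H\<close> form a subgroup, which by maximality is everything.
\<close>

lemma (in normal) comm_group_FactGroup_if_maximal:
  assumes max: "maximal_subgroup H G"
  shows "comm_group (G Mod H)"
proof -
  interpret Q: group "G Mod H" by (rule factorgroup_is_group)
  let ?\<pi> = "\<lambda>a. H #> a"
  interpret \<pi>: group_hom G "G Mod H" ?\<pi>
    using r_coset_hom_Mod by unfold_locales
  have ker: "?\<pi> h = \<one>\<^bsub>G Mod H\<^esub>" if "h \<in> H" for h
    using that rcos_const[OF is_group] by (simp add: FactGroup_def)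
  have comm: "?\<pi> a \<otimes>\<^bsub>G Mod H\<^esub> ?\<pi> b = ?\<pi> b \<otimes>\<^bsub>G Mod H\<^esub> ?\<pi> a"
    if a: "a \<in> carrier G" and b: "b \<in> carrier G" for a b
  proof (cases "a \<in> H")
    case True
    then show ?thesis
      by (simp only: ker Q.l_one[OF \<pi>.hom_closed[OF b]] Q.r_one[OF \<pi>.hom_closed[OF b]])
  next
    case False
    define C where "C = {y \<in> carrier G. ?\<pi> a \<otimes>\<^bsub>G Mod H\<^esub> ?\<pi> y = ?\<pi> y \<otimes>\<^bsub>G Mod H\<^esub> ?\<pi> a}"
    have "subgroup C G"
    proof (rule subgroupI)
      show "C \<noteq> {}" using a by (auto simp: C_def)
    next
      fix y z assume "y \<in> C" "z \<in> C"
      then have y: "y \<in> carrier G" and z: "z \<in> carrier G" and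
        e: "?\<pi> a \<otimes>\<^bsub>G Mod H\<^esub> ?\<pi> y = ?\<pi> y \<otimes>\<^bsub>G Mod H\<^esub> ?\<pi> a"
           "?\<pi> a \<otimes>\<^bsub>G Mod H\<^esub> ?\<pi> z = ?\<pi> z \<otimes>\<^bsub>G Mod H\<^esub> ?\<pi> a" by (auto simp: C_def)
      have "?\<pi> a \<otimes>\<^bsub>G Mod H\<^esub> (?\<pi> y \<otimes>\<^bsub>G Mod H\<^esub> ?\<pi> z) = ?\<pi> y \<otimes>\<^bsub>G Mod H\<^esub> ?\<pi> z \<otimes>\<^bsub>G Mod H\<^esub> ?\<pi> a"
        using e \<pi>.hom_closed[OF a] \<pi>.hom_closed[OF y] \<pi>.hom_closed[OF z] Q.m_assoc by metis
      then show "y \<otimes> z \<in> C" using y z \<pi>.hom_mult[OF y z] by (simp add: C_def del: mult_FactGroup)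
    next
      fix y assume "y \<in> C"
      then have y: "y \<in> carrier G" and
        e: "?\<pi> a \<otimes>\<^bsub>G Mod H\<^esub> ?\<pi> y = ?\<pi> y \<otimes>\<^bsub>G Mod H\<^esub> ?\<pi> a" by (auto simp: C_def)
      note c = \<pi>.hom_closed[OF a] \<pi>.hom_closed[OF y]
      have "?\<pi> y \<otimes>\<^bsub>G Mod H\<^esub> (?\<pi> a \<otimes>\<^bsub>G Mod H\<^esub> inv\<^bsub>G Mod H\<^esub> ?\<pi> y) = ?\<pi> a"
        using c e by (metis Q.inv_closed Q.inv_solve_right' Q.m_assoc Q.m_closed)
      then have "?\<pi> a \<otimes>\<^bsub>G Mod H\<^esub> inv\<^bsub>G Mod H\<^esub> ?\<pi> y = inv\<^bsub>G Mod H\<^esub> ?\<pi> y \<otimes>\<^bsub>G Mod H\<^esub> ?\<pi> a"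
        using c by (metis Q.inv_closed Q.inv_solve_left Q.m_closed)
      then show "inv y \<in> C" using y \<pi>.hom_inv[OF y] by (simp add: C_def)
    qed (auto simp: C_def)
    moreover have "H \<subseteq> C"
      using ker Q.l_one[OF \<pi>.hom_closed[OF a]] Q.r_one[OF \<pi>.hom_closed[OF a]] subset
      by (auto simp: C_def simp del: mult_FactGroup one_FactGroup)
    moreover have "a \<in> C" using a by (simp add: C_def)
    ultimately have "C = carrier G"
      using max False unfolding maximal_subgroup_def by blast
    then show ?thesis using b by (auto simp: C_def)
  qed
  show ?thesis
  proof (rule Q.group_comm_groupI)
    fix u v assume "u \<in> carrier (G Mod H)" "v \<in> carrier (G Mod H)"
    then show "u \<otimes>\<^bsub>G Mod H\<^esub> v = v \<otimes>\<^bsub>G Mod H\<^esub> u"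
      using comm by (auto simp: FactGroup_def RCOSETS_def)
  qed
qed

context group
begin

section \<open>Normal subgroups with prescribed intersection\<close>

text \<open>
  The Frobenius--Wielandt theorem for an abelian quotient \<open>M/H\<close>: the assumption \<open>small\<close> says
  that \<open>M \<inter> M\<^sup>g \<subseteq> H\<close> for \<open>g \<notin> M\<close> (with \<open>g = inv t\<close>), which makes the projection onto \<open>M/H\<close>
  trivial on these intersections. The kernel of its extension to \<open>G\<close> is the required subgroup.
\<close>

lemma normal_subgroup_if_intersections_small:
  assumes M: "subgroup M G" and fin: "finite (rcosets M)"
    and H: "H \<lhd> G\<lparr>carrier := M\<rparr>" and comm: "comm_group (G\<lparr>carrier := M\<rparr> Mod H)"
    and small: "\<And>t d. \<lbrakk>t \<in> carrier G; t \<notin> M; d \<in> M; t \<otimes> d \<otimes> inv t \<in> M\<rbrakk> \<Longrightarrow> t \<otimes> d \<otimes> inv t \<in> H"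
  shows "\<exists>L. L \<lhd> G \<and> L \<inter> M = H"
proof -
  let ?Q = "G\<lparr>carrier := M\<rparr> Mod H"
  interpret M: subgroup M G by fact
  interpret H: normal H "G\<lparr>carrier := M\<rparr>" by fact
  interpret Q: comm_group ?Q by fact
  define \<pi> where "\<pi> a = H #> a" for a
  have one: "\<one>\<^bsub>?Q\<^esub> = H" by (simp add: FactGroup_def)
  have HG: "subgroup H G"
    using incl_subgroup[OF M H.subgroup_axioms] .
  have HM: "H \<subseteq> M" using H.subset by simp
  have "\<pi> \<in> hom (G\<lparr>carrier := M\<rparr>) ?Q"
    using H.r_coset_hom_Mod by (simp add: \<pi>_def[abs_def] r_coset_def)
  moreover have \<pi>1: "\<pi> a = \<one>\<^bsub>?Q\<^esub> \<longleftrightarrow> a \<in> H" if "a \<in> M" for a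
    using that HG coset_join1 coset_join2 M.mem_carrier unfolding one \<pi>_def by metis
  ultimately obtain \<Phi> where \<Phi>: "\<Phi> \<in> hom G ?Q" and ext: "\<And>m. m \<in> M \<Longrightarrow> \<Phi> m = \<pi> m"
    using hom_extends_if_trivial_on_intersections[OF M fin comm, of \<pi>] small by metis
  interpret \<Phi>: group_hom G ?Q \<Phi> using \<Phi> by unfold_locales
  have "\<Phi> m = \<one>\<^bsub>?Q\<^esub> \<longleftrightarrow> m \<in> H" if "m \<in> M" for m
    using ext[OF that] \<pi>1[OF that] by (simp only:)
  then have "kernel G ?Q \<Phi> \<inter> M = H"
    unfolding kernel_def using HM M.subset by blast
  then show ?thesis using \<Phi>.normal_kernel by blast
qed

text \<open>
  The first case below is the one where an element of \<open>M \<inter> M\<^sup>g\<close> escapes from \<open>H\<close> and forces the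
  subgroup generated by \<open>H\<close> and \<open>H\<^sup>g\<close> to be normal in \<open>G\<close>; the second is the transfer argument.
\<close>

lemma exists_normal_subgroup_with_intersection:
  assumes fin: "finite (carrier G)" and HG: "subgroup H G" and MG: "subgroup M G" and HM: "H \<subseteq> M"
    and trap: "\<And>g. g \<in> carrier G \<Longrightarrow> generate G (H \<union> conjugate G H g) \<inter> M = H"
    and maxH: "maximal_subgroup H (G\<lparr>carrier := M\<rparr>)" and maxM: "maximal_subgroup M G"
  shows "\<exists>L. L \<lhd> G \<and> L \<inter> M = H"
proof -
  interpret H: subgroup H G by fact
  interpret M: subgroup M G by fact
  let ?K = "\<lambda>g. generate G (H \<union> conjugate G H g)"
  have conj: "conjugate G H g = (\<lambda>h. inv g \<otimes> h \<otimes> g) ` H" if "g \<in> carrier G" for g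
    using conjugate_eq_image[OF is_group H.subset that] .
  have gens: "H \<union> conjugate G H g \<subseteq> carrier G" if "g \<in> carrier G" for g
    using conj[OF that] that H.subset by auto
  have HK: "H \<subseteq> ?K g" and conjK: "\<And>h. \<lbrakk>g \<in> carrier G; h \<in> H\<rbrakk> \<Longrightarrow> inv g \<otimes> h \<otimes> g \<in> ?K g" for g
    using conj by (auto intro!: generate.incl)
  have Hinv: "inv m \<otimes> h \<otimes> m \<in> H" if "m \<in> M" "h \<in> H" for m h
    using conjK[of m h] trap[of m] that HM M.mem_carrier[OF that(1)] by auto
  have Hinv': "m \<otimes> h \<otimes> inv m \<in> H" if "m \<in> M" "h \<in> H" for m h
    using Hinv[of "inv m" h] that M.mem_carrier by simp
  have HnM: "H \<lhd> G\<lparr>carrier := M\<rparr>"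
  proof -
    interpret GM: group "G\<lparr>carrier := M\<rparr>" by (rule subgroup_imp_group[OF MG])
    show ?thesis
      unfolding GM.normal_inv_iff
      using subgroup_incl[OF HG MG HM] Hinv' m_inv_consistent[OF MG] by simp
  qed
  show ?thesis
  proof (cases "\<exists>t d. t \<in> carrier G \<and> t \<notin> M \<and> d \<in> M \<and> t \<otimes> d \<otimes> inv t \<in> M \<and> t \<otimes> d \<otimes> inv t \<notin> H")
    case True
    then obtain t e where t: "t \<in> carrier G" "t \<notin> M" and e: "e \<in> M" "t \<otimes> e \<otimes> inv t \<in> M"
      "t \<otimes> e \<otimes> inv t \<notin> H" by blast
    \<comment> \<open>The element \<open>d \<in> M \<inter> M\<^sup>g\<close> outside \<open>H\<close>; the hypothesis on generated subgroups uses
      conjugation by \<open>g = inv t\<close> in the opposite direction.\<close>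
    define g where "g = inv t"
    define d where "d = t \<otimes> e \<otimes> inv t"
    have g: "g \<in> carrier G" "g \<notin> M"
      using t M.m_inv_closed inv_inv unfolding g_def by (auto, metis)
    have eG: "e \<in> carrier G" using e by auto
    have "g \<otimes> d \<otimes> inv g = e"
      using t eG by (simp add: g_def d_def m_assoc m_inv_cancel)
    with e have d: "d \<in> M" "d \<notin> H" "g \<otimes> d \<otimes> inv g \<in> M" by (auto simp: d_def)
    have K: "subgroup (?K g) G" using generate_is_subgroup[OF gens[OF g(1)]] .
    let ?N = "normalizing_elements (?K g)"
    have N: "subgroup ?N G" using subgroup_normalizing_elements[OF subgroup.subset[OF K]] .
    have KN: "?K g \<subseteq> ?N" using subgroup_subset_normalizing_elements[OF K] .
    have stab: "x \<otimes> k \<otimes> inv x \<in> ?K g"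
      if x: "x \<in> M" "g \<otimes> x \<otimes> inv g \<in> M" and k: "k \<in> ?K g" for x k
    proof (rule conj_generate_mem[OF gens[OF g(1)] _ _ k])
      show xG: "x \<in> carrier G" using x by auto
      fix s assume "s \<in> H \<union> conjugate G H g"
      then consider "s \<in> H" | h where "h \<in> H" "s = inv g \<otimes> h \<otimes> g"
        using conj[OF g(1)] by auto
      then show "x \<otimes> s \<otimes> inv x \<in> ?K g"
      proof cases
        case 1
        then show ?thesis using Hinv'[OF x(1)] HK by auto
      next
        case 2
        let ?y = "g \<otimes> x \<otimes> inv g"
        have hG: "h \<in> carrier G" using 2 by auto
        have "x \<otimes> s \<otimes> inv x = inv g \<otimes> (?y \<otimes> h \<otimes> inv ?y) \<otimes> g"
          using g(1) xG hG 2(2) by (simp add: m_assoc inv_mult_group m_inv_cancel)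
        then show ?thesis using conjK[OF g(1) Hinv'[OF x(2) 2(1)]] by simp
      qed
    qed
    \<comment> \<open>The inverse of \<open>d\<close> lies in the same intersection, so both inclusions come from \<open>stab\<close>.\<close>
    have dN: "d \<in> ?N"
    proof -
      have dG: "d \<in> carrier G" using d by auto
      have "g \<otimes> inv d \<otimes> inv g = inv (g \<otimes> d \<otimes> inv g)"
        using g(1) dG by (simp add: inv_mult_group m_assoc)
      then have "g \<otimes> inv d \<otimes> inv g \<in> M" using d(3) by simp
      then show ?thesis
        using stab[OF d(1,3)] stab[of "inv d"] d dG by (auto simp: normalizing_elements_def)
    qed
    have MN: "M \<subseteq> ?N"
      using subset_if_maximal_and_larger[OF MG maxH N _ dN d(1,2)] HK KN by blast
    have "\<not> ?N \<subseteq> M"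
    proof (cases "?K g \<subseteq> M")
      case False
      then show ?thesis using KN by blast
    next
      case True
      then have KH: "?K g = H" using trap[OF g(1)] by auto
      \<comment> \<open>Now \<open>H\<^sup>g \<subseteq> H\<close>; finiteness turns this into equality, so \<open>g\<close> itself normalizes \<open>K = H\<close>.\<close>
      have "(\<lambda>h. inv g \<otimes> h \<otimes> g) ` H = H"
      proof (rule endo_inj_surj)
        show "finite H" using fin H.subset finite_subset by blast
        show "(\<lambda>h. inv g \<otimes> h \<otimes> g) ` H \<subseteq> H" using conjK[OF g(1)] KH by auto
        show "inj_on (\<lambda>h. inv g \<otimes> h \<otimes> g) H"
          using g(1) by (auto simp: inj_on_def)
      qed
      moreover have "g \<otimes> (inv g \<otimes> h \<otimes> g) \<otimes> inv g = h" if "h \<in> H" for h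
        using g(1) H.mem_carrier[OF that] by (simp add: m_assoc m_inv_cancel)
      ultimately have "g \<in> normalizing_elements H"
        using g(1) unfolding normalizing_elements_def by (smt (verit) image_iff mem_Collect_eq)
      then show ?thesis using g(2) KH by auto
    qed
    then have "?N = carrier G"
      using maxM N MN unfolding maximal_subgroup_def by blast
    then have "?K g \<lhd> G" using normal_if_normalizing_elements_eq[OF K] by blast
    then show ?thesis using trap[OF g(1)] by blast
  next
    case False
    have "finite (rcosets M)"
      using fin rcosets_subset_PowG[OF MG] finite_subset by blast
    then show ?thesis
      using normal_subgroup_if_intersections_small[OF MG _ HnM
          normal.comm_group_FactGroup_if_maximal[OF HnM maxH]] False
      by blast
  qed
qed

end

theorem theorem1:
  fixes G :: "('a, 'b) monoid_scheme" and H M :: "'a set"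
  assumes "group G" and "finite (carrier G)"
    and "subgroup H G" and "subgroup M G" and "H \<subseteq> M"
    and "\<And>g. g \<in> carrier G \<Longrightarrow> generate G (H \<union> conjugate G H g) \<inter> M = H"
    and "maximal_subgroup H (G\<lparr>carrier := M\<rparr>)" and "maximal_subgroup M G"
  shows "normal_closure G H \<inter> M = H"
proof -
  obtain L where L: "L \<lhd> G" "L \<inter> M = H"
    using group.exists_normal_subgroup_with_intersection[OF assms] by blast
  have "normal_closure G H \<subseteq> L" "H \<subseteq> normal_closure G H"
    unfolding normal_closure_eq_Inter[OF assms(1) subgroup.subset[OF assms(3)]] using L by blast+
  then show ?thesis using L(2) assms(5) by blast
qed

end
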